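(* Let $\Gamma$ be a finitely generated profinite group with positive rank gradient, and let $A,B$ be finitely generated closed subgroups of infinite index in $\Gamma$. Then there exists an open subgroup $B_0$ of $B$ such that the closed subgroup of $\Gamma$ generated by $A$ and $B_0$ has infinite index in $\Gamma$.
   Context: For profinite groups, only closed subgroups are considered, and generation is topological: $d(U)$ is the minimal cardinality of a subset generating a dense subgroup of $U$, and "finitely generated" means $d<\infty$. The rank gradient of a finitely generated profinite group $\Gamma$ is $\nabla\Gamma=\inf_U\frac{d(U)-1}{[\Gamma:U]}$, where $U$ ranges over the open (equivalently, closed finite index) subgroups of $\Gamma$. *)

theory Defs
  imports "HOL-Analysis.Analysis" "HOL-Algebra.Algebra"
begin

definition totally_disconnected_space :: "'a topology \<Rightarrow> bool" where
  "totally_disconnected_space T \<longleftrightarrow>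
     (\<forall>S. connectedin T S \<longrightarrow> S = {} \<or> (\<exists>x. S = {x}))"

definition profinite_group :: "('a, 'b) monoid_scheme \<Rightarrow> 'a topology \<Rightarrow> bool" where
  "profinite_group G T \<longleftrightarrow>
     group G \<and> topspace T = carrier G \<and>
     continuous_map (prod_topology T T) T (\<lambda>(x, y). x \<otimes>\<^bsub>G\<^esub> y) \<and>
     continuous_map T T (\<lambda>x. inv\<^bsub>G\<^esub> x) \<and>
     compact_space T \<and> Hausdorff_space T \<and> totally_disconnected_space T"

definition closed_subgroup :: "('a, 'b) monoid_scheme \<Rightarrow> 'a topology \<Rightarrow> 'a set \<Rightarrow> bool" where
  "closed_subgroup G T H \<longleftrightarrow> subgroup H G \<and> closedin T H"

definition open_subgroup :: "('a, 'b) monoid_scheme \<Rightarrow> 'a topology \<Rightarrow> 'a set \<Rightarrow> bool" where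
  "open_subgroup G T H \<longleftrightarrow> subgroup H G \<and> openin T H"

definition top_generates :: "('a, 'b) monoid_scheme \<Rightarrow> 'a topology \<Rightarrow> 'a set \<Rightarrow> 'a set \<Rightarrow> bool" where
  "top_generates G T S U \<longleftrightarrow> S \<subseteq> U \<and> T closure_of (generate G S) = U"

definition top_fin_gen :: "('a, 'b) monoid_scheme \<Rightarrow> 'a topology \<Rightarrow> 'a set \<Rightarrow> bool" where
  "top_fin_gen G T U \<longleftrightarrow> (\<exists>S. finite S \<and> top_generates G T S U)"

definition top_rank :: "('a, 'b) monoid_scheme \<Rightarrow> 'a topology \<Rightarrow> 'a set \<Rightarrow> nat" where
  "top_rank G T U = (LEAST n. \<exists>S. finite S \<and> card S = n \<and> top_generates G T S U)"

definition group_index :: "('a, 'b) monoid_scheme \<Rightarrow> 'a set \<Rightarrow> nat" where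
  "group_index G H = card (rcosets\<^bsub>G\<^esub> H)"

definition rank_gradient :: "('a, 'b) monoid_scheme \<Rightarrow> 'a topology \<Rightarrow> real" where
  "rank_gradient G T =
     Inf {(real (top_rank G T U) - 1) / real (group_index G U) | U. open_subgroup G T U}"

end

theory Submission
  imports Defs
begin

text \<open>
  Let \<open>\<delta> > 0\<close> be the rank gradient. If \<open>V\<close> is open, contains \<open>A\<close>, and the closed subgroup
  generated by \<open>A\<close> and \<open>B \<inter> V\<close> has finite index, then that index is at least \<open>[\<Gamma>:V]\<close>, so
  \<open>\<delta>[\<Gamma>:V] < d(A) + [B : B \<inter> V] d(B)\<close> by Schreier's bound. Hence it suffices to find \<open>V\<close> of large
  index such that \<open>[B : B \<inter> V] / [\<Gamma>:V]\<close> is small.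

  If \<open>W\<close> is open, contains \<open>B\<close> and has index so large that \<open>\<delta>[\<Gamma>:W] > d(B)\<close>, the same estimate inside
  \<open>W\<close> gives open subgroups of \<open>A\<close> and \<open>B\<close> that generate a closed subgroup \<open>H\<close> of infinite index.
  Consequently \<open>AB\<close> is covered by finitely many translates \<open>pHq\<close>. For a small open normal subgroup \<open>N\<close>
  the set \<open>NAB\<close> is then a small fraction of \<open>\<Gamma>\<close>, and for \<open>V = NA\<close> this fraction is exactly
  \<open>[B : B \<inter> V] / [\<Gamma>:V]\<close>.
\<close>

section \<open>Counting cosets and Schreier generators\<close>

context group begin

lemma rcos_eq_iff:
  assumes "subgroup H G" "x \<in> carrier G" "y \<in> carrier G"
  shows "H #> x = H #> y \<longleftrightarrow> x \<otimes> inv y \<in> H"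
  by (metis assms coset_join1 coset_mult_assoc coset_mult_inv1 coset_mult_inv2 coset_join2 inv_closed m_closed subgroup.subset)

text \<open>Each coset \<open>V #> y\<close> splits into translates of the cosets of
  \<open>N\<close> in \<open>V\<close>, so a choice of representatives \<open>r\<close> of the
  \<open>V\<close>-cosets gives a bijection. \<open>Y\<close> is an arbitrary set because the final
  count applies this to \<open>NAB\<close>, which need not be a subgroup.\<close>

lemma card_rcos_image_mult:
  assumes N: "subgroup N G" and V: "subgroup V G" and "N \<subseteq> V" and Y: "Y \<subseteq> carrier G"
  shows "card ((#>) V ` Y) * card ((#>) N ` V) = card ((#>) N ` (V <#> Y))"
proof -
  define r where "r c = (SOME x. x \<in> Y \<and> V #> x = c)" for c
  have r: "r c \<in> Y \<and> V #> r c = c" if "c \<in> (#>) V ` Y" for c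
    unfolding r_def using that by (rule_tac someI_ex) auto
  note VG = subgroup.subset[OF V] and NG = subgroup.subset[OF N]
  have "bij_betw (\<lambda>(c, d). d #> r c) ((#>) V ` Y \<times> (#>) N ` V) ((#>) N ` (V <#> Y))"
    unfolding bij_betw_def
  proof (intro conjI inj_onI equalityI subsetI)
    fix p q assume p: "p \<in> (#>) V ` Y \<times> (#>) N ` V" and q: "q \<in> (#>) V ` Y \<times> (#>) N ` V"
      and eq: "(case p of (c, d) \<Rightarrow> d #> r c) = (case q of (c, d) \<Rightarrow> d #> r c)"
    obtain c v where pe: "p = (c, N #> v)" "c \<in> (#>) V ` Y" "v \<in> V" using p by auto
    obtain e w where qe: "q = (e, N #> w)" "e \<in> (#>) V ` Y" "w \<in> V" using q by auto
    have rc: "r c \<in> carrier G" and re: "r e \<in> carrier G" and v: "v \<in> carrier G" and w: "w \<in> carrier G"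
      using r pe qe Y VG by auto
    have e1: "N #> (v \<otimes> r c) = N #> (w \<otimes> r e)"
      using eq pe qe coset_mult_assoc[OF NG v rc] coset_mult_assoc[OF NG w re] by simp
    then have "v \<otimes> r c \<otimes> inv (w \<otimes> r e) \<in> V"
      using rcos_eq_iff[OF N] v w rc re \<open>N \<subseteq> V\<close> by blast
    then have "V #> (v \<otimes> r c) = V #> (w \<otimes> r e)"
      using rcos_eq_iff[OF V] v w rc re by blast
    then have "V #> r c = V #> r e"
      using coset_mult_assoc[OF VG v rc] coset_mult_assoc[OF VG w re]
        coset_join2[OF v V pe(3)] coset_join2[OF w V qe(3)] by simp
    then have ce: "c = e" using r pe qe by metis
    have "(N #> v) #> r c #> inv (r c) = (N #> w) #> r c #> inv (r c)"
      using eq pe qe ce by simp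
    then have "N #> v = N #> w"
      using v w rc NG by (simp add: coset_mult_assoc m_assoc)
    then show "p = q" using pe qe ce by simp
  next
    fix z assume "z \<in> (\<lambda>(c, d). d #> r c) ` ((#>) V ` Y \<times> (#>) N ` V)"
    then obtain c v where c: "c \<in> (#>) V ` Y" "v \<in> V" "z = (N #> v) #> r c" by auto
    then have "z = N #> (v \<otimes> r c)"
      using coset_mult_assoc[OF NG] r VG Y by (metis subsetD)
    moreover have "v \<otimes> r c \<in> V <#> Y" using c r by (auto simp: set_mult_def)
    ultimately show "z \<in> (#>) N ` (V <#> Y)" by blast
  next
    fix z assume "z \<in> (#>) N ` (V <#> Y)"
    then obtain v x where vx: "v \<in> V" "x \<in> Y" "z = N #> (v \<otimes> x)" by (auto simp: set_mult_def)
    define c where "c = V #> x"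
    have c: "c \<in> (#>) V ` Y" using vx c_def by auto
    have rc: "r c \<in> carrier G" and x: "x \<in> carrier G" and v: "v \<in> carrier G"
      using r[OF c] Y vx VG by auto
    have "x \<otimes> inv (r c) \<in> V" using r[OF c] rcos_eq_iff[OF V x rc] c_def by simp
    then have w: "v \<otimes> (x \<otimes> inv (r c)) \<in> V" using V vx by (simp add: subgroup.m_closed)
    have "v \<otimes> (x \<otimes> inv (r c)) \<otimes> r c = v \<otimes> x"
      using v x rc by (simp add: m_assoc)
    then have "z = (N #> (v \<otimes> (x \<otimes> inv (r c)))) #> r c"
      using coset_mult_assoc[OF NG _ rc] w VG vx by (metis subsetD)
    then show "z \<in> (\<lambda>(c, d). d #> r c) ` ((#>) V ` Y \<times> (#>) N ` V)"
      using c w by (intro image_eqI[of _ _ "(c, N #> (v \<otimes> (x \<otimes> inv (r c))))"]) auto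
  qed
  then show ?thesis using bij_betw_same_card card_cartesian_product by metis
qed

lemma rcosets_eq_image: "rcosets H = (#>) H ` carrier G"
  by (auto simp: RCOSETS_def)

lemma card_rcosets_mult:
  assumes "subgroup N G" "subgroup V G" "N \<subseteq> V"
  shows "card (rcosets N) = card (rcosets V) * card ((#>) N ` V)"
proof -
  have "V <#> carrier G = carrier G"
    using assms(2) subgroup.one_closed[OF assms(2)] subgroup.subset[OF assms(2)]
    by (force simp: set_mult_def)
  then show ?thesis
    using card_rcos_image_mult[OF assms, of "carrier G"] by (simp add: rcosets_eq_image)
qed

text \<open>Left multiplication by \<open>V\<close> sends \<open>N #> x\<close> to
  \<open>V #> x\<close>, hence maps the cosets of \<open>N\<close> onto those of
  \<open>V\<close>.\<close>

lemma rcosets_finite_mono: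
  assumes "subgroup N G" "subgroup V G" "N \<subseteq> V" "finite (rcosets N)"
  shows "finite (rcosets V)" "card (rcosets V) \<le> card (rcosets N)"
proof -
  have "(#>) V ` carrier G = (<#>) V ` ((#>) N ` carrier G)"
  proof -
    have "V <#> (N #> x) = V #> x" if "x \<in> carrier G" for x
    proof -
      have "V <#> N = V"
      proof
        show "V <#> N \<subseteq> V"
          using assms(3) subgroup.m_closed[OF assms(2)] unfolding set_mult_def by blast
        show "V \<subseteq> V <#> N"
        proof
          fix v assume "v \<in> V"
          then have "v = v \<otimes> \<one>" using subgroup.mem_carrier[OF assms(2)] by simp
          then show "v \<in> V <#> N"
            using \<open>v \<in> V\<close> subgroup.one_closed[OF assms(1)] unfolding set_mult_def by blast
        qed
      qed
      then show ?thesis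
        using setmult_rcos_assoc[of V N x] that assms subgroup.subset by metis
    qed
    then show ?thesis unfolding image_image by (metis (no_types, lifting) image_cong)
  qed
  then show "finite (rcosets V)" "card (rcosets V) \<le> card (rcosets N)"
    using assms(4) by (simp_all add: rcosets_eq_image card_image_le)
qed

text \<open>Schreier's lemma inside \<open>D\<close>, the group generated by \<open>S\<close>: the
  cosets of \<open>V\<close> that meet \<open>D\<close> stand for the cosets of
  \<open>D \<inter> V\<close> in \<open>D\<close>, and the new generators are
  \<open>x \<otimes> y\<close> divided by the representative of its coset.\<close>

lemma schreier_generators:
  assumes S: "S \<subseteq> carrier G" "finite S" and V: "subgroup V G"
    and fin: "finite ((#>) V ` generate G S)"
  shows "\<exists>S'. finite S' \<and> card S' \<le> card ((#>) V ` generate G S) * card S \<and>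
    generate G S' = generate G S \<inter> V"
proof -
  define D where "D = generate G S"
  have D: "subgroup D G" unfolding D_def using S(1) by (rule generate_is_subgroup)
  note DG = subgroup.subset[OF D] and VG = subgroup.subset[OF V]
  have SD: "S \<subseteq> D" unfolding D_def by (auto intro: generate.incl)
  \<comment> \<open>The coset \<open>V\<close> gets the representative \<open>\<one>\<close>, so
    that an element of \<open>D \<inter> V\<close> written as \<open>k \<otimes> x\<close> with
    \<open>x \<in> R\<close> must have \<open>x = \<one>\<close>.\<close>
  define rep where "rep c = (if c = V then \<one> else SOME x. x \<in> D \<and> V #> x = c)" for c
  have rep: "rep c \<in> D \<and> V #> rep c = c" if "c \<in> (#>) V ` D" for c
  proof (cases "c = V")
    case True
    then show ?thesis using subgroup.one_closed[OF D] coset_mult_one[OF VG] by (simp add: rep_def)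
  next
    case False
    have "\<exists>x. x \<in> D \<and> V #> x = c" using that by auto
    from someI_ex[OF this] show ?thesis using False by (simp add: rep_def)
  qed
  define R where "R = rep ` ((#>) V ` D)"
  define s where "s = (\<lambda>(x, y). x \<otimes> y \<otimes> inv (rep (V #> (x \<otimes> y))))"
  define S' where "S' = s ` (R \<times> S)"
  have finR: "finite R" and cardR: "card R \<le> card ((#>) V ` D)"
    using fin unfolding R_def D_def by (simp_all add: card_image_le)
  have fS': "finite S'" unfolding S'_def using finR S by simp
  have "card S' \<le> card R * card S"
    unfolding S'_def using card_image_le[of "R \<times> S" s] finR S by (simp add: card_cartesian_product)
  then have cS': "card S' \<le> card ((#>) V ` D) * card S"
    using cardR by (meson le_trans mult_le_mono1)
  have RD: "R \<subseteq> D" using rep R_def by auto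
  have repR: "rep (V #> x) = x" if "x \<in> R" for x
    using that rep unfolding R_def by force
  have S'DV: "S' \<subseteq> D \<inter> V"
  proof
    fix z assume "z \<in> S'"
    then obtain x y where xy: "x \<in> R" "y \<in> S" "z = x \<otimes> y \<otimes> inv (rep (V #> (x \<otimes> y)))"
      unfolding S'_def s_def by auto
    have xyD: "x \<otimes> y \<in> D" using xy RD SD D by (meson subgroup.m_closed subsetD)
    then have r: "rep (V #> (x \<otimes> y)) \<in> D" "V #> rep (V #> (x \<otimes> y)) = V #> (x \<otimes> y)" using rep by auto
    then show "z \<in> D \<inter> V"
      using rcos_eq_iff[OF V, of "x \<otimes> y" "rep (V #> (x \<otimes> y))"] xyD DG xy D
      by (auto simp: subgroup.m_closed subgroup.m_inv_closed subsetD)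
  qed
  define K where "K = generate G S'"
  have K: "subgroup K G" unfolding K_def using S'DV DG by (rule_tac generate_is_subgroup) auto
  have KDV: "K \<subseteq> D \<inter> V"
    unfolding K_def using S'DV D V by (intro generate_subgroup_incl) (auto intro: subgroups_Inter_pair)
  note KG = subgroup.subset[OF K]
  have RG: "R \<subseteq> carrier G" using RD DG by auto
  \<comment> \<open>\<open>K <#> R\<close> is stable under right multiplication by generators and
    their inverses; as it contains \<open>\<one>\<close>, it contains all of
    \<open>D\<close>.\<close>
  have step: "k \<otimes> x \<otimes> y \<in> K <#> R" if kxy: "k \<in> K" "x \<in> R" "y \<in> S \<union> m_inv G ` S" for k x y
  proof -
    have kc: "k \<in> carrier G" and xc: "x \<in> carrier G" using kxy KG RG by auto
    consider "y \<in> S" | t where "t \<in> S" "y = inv t" using kxy by auto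
    then obtain k' x' where *: "k' \<in> K" "x' \<in> R" "x \<otimes> y = k' \<otimes> x'"
    proof cases
      case 1
      let ?r = "rep (V #> (x \<otimes> y))"
      have "x \<otimes> y \<in> D" using 1 kxy RD SD D by (meson subgroup.m_closed subsetD)
      then have rR: "?r \<in> R" unfolding R_def by auto
      have "x \<otimes> y \<otimes> inv ?r \<in> K"
        unfolding K_def S'_def s_def using 1 kxy by (intro generate.incl) auto
      moreover have "x \<otimes> y = (x \<otimes> y \<otimes> inv ?r) \<otimes> ?r"
        using xc rR RG 1 S by (simp add: m_assoc subsetD)
      ultimately show ?thesis using rR by (intro that) blast+
    next
      case 2
      let ?r = "rep (V #> (x \<otimes> y))"
      have tc: "t \<in> carrier G" using 2 S by auto
      have xyD: "x \<otimes> y \<in> D" using 2 kxy RD SD D by (meson subgroup.m_closed subgroup.m_inv_closed subsetD)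
      then have rR: "?r \<in> R" unfolding R_def by auto
      have rc: "?r \<in> carrier G" using rR RG by auto
      \<comment> \<open>For an inverse letter, start from the target: \<open>?r \<otimes> t\<close>
        lies in the coset represented by \<open>x\<close>, so
        \<open>?r \<otimes> t \<otimes> inv x\<close> is a Schreier generator, and its inverse
        carries \<open>?r\<close> to \<open>x \<otimes> inv t\<close>.\<close>
      have "V #> (?r \<otimes> t) = V #> ?r #> t"
        using coset_mult_assoc[OF VG rc tc] by simp
      also have "\<dots> = V #> (x \<otimes> y) #> t" using rep xyD by simp
      also have "\<dots> = V #> (x \<otimes> y \<otimes> t)" using coset_mult_assoc[OF VG _ tc] xyD DG by blast
      also have "x \<otimes> y \<otimes> t = x" using 2 xc tc by (simp add: m_assoc)
      finally have "rep (V #> (?r \<otimes> t)) = x" using repR kxy by simp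
      then have "?r \<otimes> t \<otimes> inv x \<in> S'"
        unfolding S'_def s_def using rR 2 by (intro image_eqI[of _ _ "(?r, t)"]) auto
      then have "inv (?r \<otimes> t \<otimes> inv x) \<in> K"
        unfolding K_def by (metis K_def K generate.incl subgroup.m_inv_closed)
      moreover have "x \<otimes> y = inv (?r \<otimes> t \<otimes> inv x) \<otimes> ?r"
        using xc rc tc 2 by (simp add: inv_mult_group m_assoc)
      ultimately show ?thesis using rR by (intro that) blast+
    qed
    have yc: "y \<in> carrier G" using kxy S by auto
    have "k \<otimes> x \<otimes> y = (k \<otimes> k') \<otimes> x'"
      using * kc xc yc KG RG by (metis m_assoc subsetD)
    moreover have "k \<otimes> k' \<in> K" using kxy * K by (simp add: subgroup.m_closed)
    ultimately show ?thesis using * by (auto simp: set_mult_def)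
  qed
  have KRG: "K <#> R \<subseteq> carrier G" using KG RG by (simp add: set_mult_closed)
  \<comment> \<open>Quantifying over all \<open>z\<close> lets the product case of the induction
    apply the two hypotheses one after the other.\<close>
  have "x \<in> carrier G \<and> (\<forall>z \<in> K <#> R. z \<otimes> x \<in> K <#> R)" if "x \<in> generate G S" for x
    using that
  proof induction
    case one
    then show ?case using KRG by auto
  next
    case (incl h)
    then show ?case using step S by (auto simp: set_mult_def)
  next
    case (inv h)
    then show ?case using step S by (auto simp: set_mult_def)
  next
    case (eng h1 h2)
    then show ?case using KRG m_assoc by (metis m_closed subsetD)
  qed
  moreover have "\<one> \<in> K <#> R"
  proof -
    have "V \<in> (#>) V ` D" using subgroup.one_closed[OF D] coset_mult_one[OF VG] by force
    then have "\<one> \<in> R" unfolding R_def rep_def by force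
    then show ?thesis using subgroup.one_closed[OF K] by (force simp: set_mult_def)
  qed
  ultimately have DKR: "D \<subseteq> K <#> R" unfolding D_def by (metis l_one subsetI)
  have "D \<inter> V \<subseteq> K"
  proof
    fix z assume z: "z \<in> D \<inter> V"
    then obtain k x where kx: "k \<in> K" "x \<in> R" "z = k \<otimes> x" using DKR by (auto simp: set_mult_def)
    have kc: "k \<in> carrier G" and xc: "x \<in> carrier G" using kx KG RG by auto
    have "x = inv k \<otimes> z" using kx kc xc by (simp add: inv_solve_left)
    moreover have "inv k \<otimes> z \<in> V"
      using kx(1) KDV z subgroup.m_closed[OF V] subgroup.m_inv_closed[OF V] by blast
    ultimately have "x \<in> V" by simp
    then have "V #> x = V" using coset_join2[OF xc V] by simp
    then have "x = \<one>" using repR[OF kx(2)] by (simp add: rep_def)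
    then show "z \<in> K" using kx kc by simp
  qed
  then show ?thesis using fS' cS' KDV unfolding K_def D_def by blast
qed

text \<open>Normality turns \<open>N #> (p \<otimes> x \<otimes> q)\<close> into
  \<open>p <# (N #> x) #> q\<close>, so the two-sided translation acts on whole cosets of
  \<open>N\<close>.\<close>

lemma card_rcos_image_translate_le:
  assumes N: "N \<lhd> G" and M: "M \<subseteq> carrier G" "finite ((#>) N ` M)"
    and pq: "p \<in> carrier G" "q \<in> carrier G"
  shows "finite ((#>) N ` (\<lambda>x. p \<otimes> x \<otimes> q) ` M)"
    and "card ((#>) N ` (\<lambda>x. p \<otimes> x \<otimes> q) ` M) \<le> card ((#>) N ` M)"
proof -
  have NG: "N \<subseteq> carrier G" using N normal_imp_subgroup subgroup.subset by blast
  have "N #> (p \<otimes> x \<otimes> q) = p <# (N #> x) #> q" if "x \<in> M" for x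
  proof -
    have x: "x \<in> carrier G" using that M by auto
    have "N #> (p \<otimes> x \<otimes> q) = (N #> p) #> x #> q"
      using x pq NG by (simp add: coset_mult_assoc)
    also have "N #> p = p <# N" using normal.coset_eq[OF N] pq by blast
    also have "(p <# N) #> x = p <# (N #> x)" using coset_assoc[of p x N] x pq NG by simp
    finally show ?thesis .
  qed
  then have "(#>) N ` (\<lambda>x. p \<otimes> x \<otimes> q) ` M = (\<lambda>c. p <# c #> q) ` ((#>) N ` M)"
    unfolding image_image by (rule image_cong[OF refl])
  then show "finite ((#>) N ` (\<lambda>x. p \<otimes> x \<otimes> q) ` M)"
    and "card ((#>) N ` (\<lambda>x. p \<otimes> x \<otimes> q) ` M) \<le> card ((#>) N ` M)"
    using M(2) by (simp_all add: card_image_le)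
qed

end

section \<open>Open normal subgroups of profinite groups\<close>

locale profinite = group G for G (structure) +
  fixes T
  assumes profinite: "profinite_group G T"
begin

lemma topspace_eq [simp]: "topspace T = carrier G"
  and compact: "compact_space T" and Hausdorff: "Hausdorff_space T"
  and totally_disconnected: "totally_disconnected_space T"
  and continuous_inv: "continuous_map T T (\<lambda>x. inv x)"
  using profinite by (auto simp: profinite_group_def)

lemma continuous_mult:
  assumes "continuous_map Z T f" "continuous_map Z T g"
  shows "continuous_map Z T (\<lambda>x. f x \<otimes> g x)"
proof -
  have "continuous_map (prod_topology T T) T (\<lambda>(x, y). x \<otimes> y)"
    using profinite by (simp add: profinite_group_def)
  from continuous_map_compose[OF continuous_map_pairedI[OF assms] this]
  show ?thesis by (simp add: comp_def)
qed

lemma r_coset_eq_vimage: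
  assumes "U \<subseteq> carrier G" "a \<in> carrier G"
  shows "U #> a = {x \<in> topspace T. x \<otimes> inv a \<in> U}"
proof -
  have "x \<in> U #> a" if "x \<in> carrier G" "x \<otimes> inv a \<in> U" for x
  proof -
    have "x = (x \<otimes> inv a) \<otimes> a" using that assms by (simp add: m_assoc)
    then show ?thesis using that unfolding r_coset_def by blast
  qed
  moreover have "x \<in> carrier G \<and> x \<otimes> inv a \<in> U" if x: "x \<in> U #> a" for x
  proof -
    obtain u where "u \<in> U" "x = u \<otimes> a" using x by (auto simp: r_coset_def)
    then show ?thesis using assms by (auto simp: m_assoc subsetD)
  qed
  ultimately show ?thesis by auto
qed

lemma openin_r_coset:
  assumes "openin T U" "a \<in> carrier G"
  shows "openin T (U #> a)"
proof -
  have "continuous_map T T (\<lambda>x. x \<otimes> inv a)"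
    by (intro continuous_mult) (use assms in auto)
  from openin_continuous_map_preimage[OF this assms(1)] show ?thesis
    using r_coset_eq_vimage[of U a] assms openin_subset[OF assms(1)] by simp
qed

lemma closedin_r_coset:
  assumes "closedin T U" "a \<in> carrier G"
  shows "closedin T (U #> a)"
proof -
  have "continuous_map T T (\<lambda>x. x \<otimes> inv a)"
    by (intro continuous_mult) (use assms in auto)
  from closedin_continuous_map_preimage[OF this assms(1)] show ?thesis
    using r_coset_eq_vimage[of U a] assms closedin_subset[OF assms(1)] by simp
qed

text \<open>A union of translates of \<open>H\<close>: this makes open subgroups closed and closed
  subgroups of finite index open.\<close>

lemma subgroup_complement:
  assumes H: "subgroup H G"
  shows "carrier G - H = \<Union>(rcosets H - {H})"
proof -
  have "H \<in> rcosets H" by (rule subgroup.subgroup_in_rcosets[OF H is_group])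
  moreover have "H \<inter> C = {}" if "C \<in> rcosets H" "C \<noteq> H" for C
    using rcos_disjoint[OF H] calculation that by (auto simp: pairwise_def disjnt_def)
  moreover have "\<Union>(rcosets H) = carrier G" by (rule rcosets_part_G[OF H])
  ultimately show ?thesis by blast
qed

lemma open_subgroup_closed:
  assumes "subgroup H G" "openin T H"
  shows "closedin T H"
proof -
  have "openin T (carrier G - H)"
    unfolding subgroup_complement[OF assms(1)]
    by (rule openin_Union) (use openin_r_coset[OF assms(2)] in \<open>auto simp: RCOSETS_def\<close>)
  then show ?thesis using subgroup.subset[OF assms(1)] by (simp add: closedin_def)
qed

lemma closed_finite_index_subgroup_open:
  assumes "subgroup H G" "closedin T H" "finite (rcosets H)"
  shows "openin T H"
proof -
  have "closedin T (carrier G - H)"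
    unfolding subgroup_complement[OF assms(1)]
    by (rule closedin_Union) (use assms closedin_r_coset[OF assms(2)] in \<open>auto simp: RCOSETS_def\<close>)
  then show ?thesis using subgroup.subset[OF assms(1)]
    by (simp add: openin_closedin_eq)
qed

text \<open>The cosets form an open cover by disjoint nonempty sets, so a finite subcover must
  already contain every coset.\<close>

lemma open_subgroup_finite_index:
  assumes "subgroup H G" "openin T H"
  shows "finite (rcosets H)"
proof -
  have "\<And>U. U \<in> rcosets H \<Longrightarrow> openin T U"
    using openin_r_coset[OF assms(2)] by (auto simp: RCOSETS_def)
  moreover have U: "\<Union>(rcosets H) = carrier G" by (rule rcosets_part_G[OF assms(1)])
  ultimately obtain F where F: "finite F" "F \<subseteq> rcosets H" "carrier G \<subseteq> \<Union>F"
    using compact unfolding compact_space_alt by (metis order_refl topspace_eq)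
  have "rcosets H \<subseteq> F"
  proof
    fix C assume C: "C \<in> rcosets H"
    then obtain x where x: "x \<in> C" "x \<in> carrier G"
      using rcos_self[OF _ assms(1)] by (auto simp: RCOSETS_def)
    then obtain D where D: "D \<in> F" "x \<in> D" using F by auto
    then have "C = D" using rcos_disjoint[OF assms(1)] C F x
      by (auto simp: pairwise_def disjnt_def)
    then show "C \<in> F" using D by simp
  qed
  then show ?thesis using F finite_subset by blast
qed

lemma closure_of_subgroup:
  assumes H: "subgroup H G"
  shows "subgroup (T closure_of H) G"
proof
  note HG = subgroup.subset[OF H]
  let ?C = "Abstract_Topology.closure_of T H"
  have HC: "H \<subseteq> ?C" using HG by (simp add: closure_of_subset)
  show "?C \<subseteq> carrier G" using closure_of_subset_topspace by force
  show "\<one> \<in> ?C" using subgroup.one_closed[OF H] HC by blast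
  show "inv x \<in> ?C" if "x \<in> ?C" for x
  proof -
    have "(\<lambda>x. inv x) ` ?C \<subseteq> T closure_of ((\<lambda>x. inv x) ` H)"
      using continuous_map_image_closure_subset[OF continuous_inv] .
    moreover have "(\<lambda>x. inv x) ` H \<subseteq> H" using subgroup.m_inv_closed[OF H] by blast
    ultimately show ?thesis using closure_of_mono that by blast
  qed
  show "x \<otimes> y \<in> ?C" if "x \<in> ?C" "y \<in> ?C" for x y
  proof -
    have "(\<lambda>(x, y). x \<otimes> y) ` (prod_topology T T closure_of (H \<times> H))
      \<subseteq> T closure_of ((\<lambda>(x, y). x \<otimes> y) ` (H \<times> H))"
      using profinite by (intro continuous_map_image_closure_subset) (simp add: profinite_group_def)
    moreover have "(\<lambda>(x, y). x \<otimes> y) ` (H \<times> H) \<subseteq> H" using subgroup.m_closed[OF H] by auto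
    moreover have "(x, y) \<in> prod_topology T T closure_of (H \<times> H)"
      using that by (simp add: closure_of_Times)
    ultimately have "(\<lambda>(x, y). x \<otimes> y) (x, y) \<in> ?C"
      using closure_of_mono[of _ H T] by blast
    then show ?thesis by simp
  qed
qed

text \<open>In a compact Hausdorff space, a point and a closed set that no connected set joins are
  separated by a clopen set; here connected sets have at most one point.\<close>

lemma clopen_neighbourhood:
  assumes "openin T U" "x \<in> U"
  obtains K where "openin T K" "closedin T K" "x \<in> K" "K \<subseteq> U"
proof -
  have x: "x \<in> carrier G" using assms openin_subset by force
  have "separated_between T {x} (topspace T - U)"
  proof (rule cut_wire_fence_theorem[OF compact Hausdorff])
    show "closedin T {x}" using x Hausdorff by (simp add: closedin_Hausdorff_singleton)
    show "closedin T (topspace T - U)" using assms by blast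
    show "disjnt C {x} \<or> disjnt C (topspace T - U)" if "connectedin T C" for C
      using totally_disconnected that assms unfolding totally_disconnected_space_def disjnt_def by blast
  qed
  then obtain K where "closedin T K" "openin T K" "x \<in> K" "topspace T - U \<subseteq> topspace T - K"
    unfolding separated_between by auto
  moreover from this have "K \<subseteq> U" using openin_subset by blast
  ultimately show ?thesis using that by blast
qed

lemma open_normal_subgroup_in_neighbourhood:
  assumes "openin T U" "\<one> \<in> U"
  obtains N where "N \<lhd> G" "openin T N" "N \<subseteq> U"
proof -
  obtain K where K: "openin T K" "closedin T K" "\<one> \<in> K" "K \<subseteq> U"
    using clopen_neighbourhood[OF assms] .
  \<comment> \<open>The set of \<open>x\<close> that can be inserted anywhere in a product without changing membership in \<open>K\<close> is
    a normal subgroup, and its complement is the projection of a closed set along a compact factor.\<close>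
  define N where "N = {x \<in> carrier G. \<forall>h\<in>carrier G. \<forall>g\<in>carrier G. h \<otimes> g \<in> K \<longleftrightarrow> h \<otimes> x \<otimes> g \<in> K}"
  have NG: "N \<subseteq> carrier G" by (auto simp: N_def)
  have ND: "h \<otimes> g \<in> K \<longleftrightarrow> h \<otimes> x \<otimes> g \<in> K" if "x \<in> N" "h \<in> carrier G" "g \<in> carrier G" for x h g
    using that by (simp add: N_def)
  have sub: "subgroup N G"
  proof
    show "N \<subseteq> carrier G" by fact
    show "\<one> \<in> N" by (simp add: N_def)
    show "x \<otimes> y \<in> N" if x: "x \<in> N" and y: "y \<in> N" for x y
    proof -
      have c: "x \<in> carrier G" "y \<in> carrier G" using x y NG by auto
      have "h \<otimes> g \<in> K \<longleftrightarrow> h \<otimes> (x \<otimes> y) \<otimes> g \<in> K" if "h \<in> carrier G" "g \<in> carrier G" for h g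
        using ND[OF x that] ND[OF y, of "h \<otimes> x" g] that c by (simp add: m_assoc)
      then show ?thesis using c by (simp add: N_def)
    qed
    show "inv x \<in> N" if x: "x \<in> N" for x
    proof -
      have c: "x \<in> carrier G" using x NG by auto
      have "h \<otimes> g \<in> K \<longleftrightarrow> h \<otimes> inv x \<otimes> g \<in> K" if "h \<in> carrier G" "g \<in> carrier G" for h g
        using ND[OF x, of "h \<otimes> inv x" g] that c by (simp add: m_assoc)
      then show ?thesis using c by (simp add: N_def)
    qed
  qed
  have "a \<otimes> x \<otimes> inv a \<in> N" if a: "a \<in> carrier G" and x: "x \<in> N" for a x
  proof -
    have c: "x \<in> carrier G" using x NG by auto
    have "h \<otimes> g \<in> K \<longleftrightarrow> h \<otimes> (a \<otimes> x \<otimes> inv a) \<otimes> g \<in> K" if "h \<in> carrier G" "g \<in> carrier G" for h g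
    proof -
      have "(h \<otimes> a) \<otimes> (inv a \<otimes> g) = h \<otimes> (a \<otimes> (inv a \<otimes> g))" using that a by (simp only: m_assoc inv_closed m_closed)
      also have "\<dots> = h \<otimes> g" using that a by (simp add: m_assoc[symmetric])
      finally show ?thesis
        using ND[OF x, of "h \<otimes> a" "inv a \<otimes> g"] that a c by (simp add: m_assoc)
    qed
    then show ?thesis using c a by (simp add: N_def)
  qed
  then have "N \<lhd> G" using sub by (simp add: normal_inv_iff)
  moreover have "openin T N"
  proof -
    let ?P = "prod_topology (prod_topology T T) T"
    let ?f = "\<lambda>p. fst (fst p) \<otimes> snd (fst p)" and ?g = "\<lambda>p. fst (fst p) \<otimes> snd p \<otimes> snd (fst p)"
    have c: "continuous_map ?P T (\<lambda>p. fst (fst p))" "continuous_map ?P T (\<lambda>p. snd (fst p))"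
        "continuous_map ?P T snd"
      by (auto intro: continuous_map_fst continuous_map_snd continuous_map_fst_of[unfolded comp_def] continuous_map_snd_of[unfolded comp_def])
    have f: "continuous_map ?P T ?f" and g: "continuous_map ?P T ?g"
      using c by (auto intro: continuous_mult)
    have K': "closedin T (carrier G - K)" using K by (metis closedin_diff closedin_topspace topspace_eq)
    \<comment> \<open>The triples \<open>((h, g), x)\<close> showing that \<open>x\<close> is not in
      \<open>N\<close>. This set is closed because both \<open>K\<close> and its complement
      are.\<close>
    let ?C = "({p \<in> topspace ?P. ?f p \<in> K} \<inter> {p \<in> topspace ?P. ?g p \<in> carrier G - K})
      \<union> ({p \<in> topspace ?P. ?f p \<in> carrier G - K} \<inter> {p \<in> topspace ?P. ?g p \<in> K})"
    have "closedin ?P ?C"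
      by (intro closedin_Un closedin_Int closedin_continuous_map_preimage[OF f] closedin_continuous_map_preimage[OF g] K K')
    moreover have "closed_map ?P T snd"
      by (intro Abstract_Topological_Spaces.closed_map_snd) (simp add: compact compact_space_prod_topology)
    ultimately have "closedin T (snd ` ?C)" by (simp add: closed_map_def)
    moreover have "carrier G - N = snd ` ?C"
    proof (intro equalityI subsetI)
      fix x assume "x \<in> carrier G - N"
      then obtain h g where hg: "x \<in> carrier G" "h \<in> carrier G" "g \<in> carrier G"
          "h \<otimes> g \<in> K \<longleftrightarrow> h \<otimes> x \<otimes> g \<notin> K"
        by (auto simp: N_def)
      then show "x \<in> snd ` ?C" by (intro image_eqI[of _ _ "((h, g), x)"]) auto
    next
      fix x assume "x \<in> snd ` ?C"
      then obtain h g where "x \<in> carrier G" "h \<in> carrier G" "g \<in> carrier G"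
          "h \<otimes> g \<in> K \<longleftrightarrow> h \<otimes> x \<otimes> g \<notin> K"
        by auto
      then show "x \<in> carrier G - N" unfolding N_def by blast
    qed
    ultimately show ?thesis using NG by (metis closedin_def double_diff openin_closedin_eq order_refl topspace_eq)
  qed
  moreover have "N \<subseteq> U"
  proof
    fix x assume "x \<in> N"
    moreover from this have "x \<in> carrier G" using NG by blast
    ultimately show "x \<in> U" using ND[of x \<one> \<one>] K by auto
  qed
  ultimately show ?thesis using that by blast
qed

lemma normal_mult_open:
  assumes N: "N \<lhd> G" "openin T N" and C: "subgroup C G"
  shows "subgroup (N <#> C) G" "openin T (N <#> C)" "N \<subseteq> N <#> C" "C \<subseteq> N <#> C"
proof -
  have sN: "subgroup N G" using N normal_imp_subgroup by blast
  show "subgroup (N <#> C) G" using mult_norm_subgroup[OF N(1) C] .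
  have "N <#> C = (\<Union>c\<in>C. N #> c)" by (auto simp: set_mult_def r_coset_def)
  then show "openin T (N <#> C)"
    using openin_r_coset[OF N(2)] subgroup.mem_carrier[OF C] by (auto intro!: openin_Union)
  show "N \<subseteq> N <#> C"
  proof
    fix x assume "x \<in> N"
    moreover from this have "x = x \<otimes> \<one>" using subgroup.mem_carrier[OF sN] by simp
    ultimately show "x \<in> N <#> C" using subgroup.one_closed[OF C] unfolding set_mult_def by blast
  qed
  show "C \<subseteq> N <#> C"
  proof
    fix x assume "x \<in> C"
    moreover from this have "x = \<one> \<otimes> x" using subgroup.mem_carrier[OF C] by simp
    ultimately show "x \<in> N <#> C" using subgroup.one_closed[OF sN] unfolding set_mult_def by blast
  qed
qed

text \<open>Finitely many distinct cosets of the closed subgroup \<open>C\<close> stay distinct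
  after \<open>C\<close> is thickened by a small enough \<open>N\<close>. The neighbourhood
  \<open>U\<close> allows \<open>N\<close> to be chosen inside an earlier subgroup.\<close>

lemma open_normal_subgroup_large_index:
  assumes C: "subgroup C G" "closedin T C" "infinite (rcosets C)"
    and U: "openin T U" "\<one> \<in> U"
  obtains N where "N \<lhd> G" "openin T N" "N \<subseteq> U" "M \<le> card (rcosets (N <#> C))"
proof -
  obtain F where F: "finite F" "card F = M" "F \<subseteq> rcosets C"
    using infinite_arbitrarily_large[OF C(3)] by blast
  have "\<forall>c\<in>F. \<exists>x. x \<in> carrier G \<and> C #> x = c"
    using F by (auto simp: RCOSETS_def)
  then obtain r where r: "\<And>c. c \<in> F \<Longrightarrow> r c \<in> carrier G \<and> C #> r c = c" by metis
  define I where "I = {(c, d) \<in> F \<times> F. c \<noteq> d}"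
  have I: "finite I" unfolding I_def by (rule finite_subset[of _ "F \<times> F"]) (use F in auto)
  \<comment> \<open>The \<open>x\<close> in \<open>U\<close> whose product with each quotient
    \<open>r c \<otimes> inv (r d)\<close>, for \<open>c \<noteq> d\<close>, avoids
    \<open>C\<close>. It is open as \<open>C\<close> is closed and there are finitely many
    pairs.\<close>
  define O' where "O' = U \<inter> ((\<Inter>(c, d)\<in>I. {x \<in> topspace T. x \<otimes> (r c \<otimes> inv (r d)) \<in> topspace T - C}) \<inter> topspace T)"
  have "openin T {x \<in> topspace T. x \<otimes> (r c \<otimes> inv (r d)) \<in> topspace T - C}" if "(c, d) \<in> I" for c d
  proof (rule openin_continuous_map_preimage[where Y=T])
    show "continuous_map T T (\<lambda>x. x \<otimes> (r c \<otimes> inv (r d)))"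
      using r that by (intro continuous_mult) (auto simp: I_def)
    show "openin T (topspace T - C)" using C by blast
  qed
  then have "openin T O'"
    unfolding O'_def using I U by (intro openin_Int openin_INT) auto
  moreover have "\<one> \<in> O'"
  proof -
    have "r c \<otimes> inv (r d) \<notin> C" if "(c, d) \<in> I" for c d
      using rcos_eq_iff[OF C(1), of "r c" "r d"] r that unfolding I_def by auto
    then show ?thesis using U r unfolding O'_def I_def by auto
  qed
  ultimately obtain N where N: "N \<lhd> G" "openin T N" "N \<subseteq> O'"
    using open_normal_subgroup_in_neighbourhood by blast
  have sN: "subgroup N G" using N normal_imp_subgroup by blast
  note V = normal_mult_open[OF N(1,2) C(1)]
  have "inj_on (\<lambda>c. (N <#> C) #> r c) F"
  proof (rule inj_onI, rule ccontr)
    fix c d assume cd: "c \<in> F" "d \<in> F" "(N <#> C) #> r c = (N <#> C) #> r d" "c \<noteq> d"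
    then have "r c \<otimes> inv (r d) \<in> N <#> C"
      using rcos_eq_iff[OF V(1)] r by blast
    then obtain n k where nk: "n \<in> N" "k \<in> C" "r c \<otimes> inv (r d) = n \<otimes> k"
      by (auto simp: set_mult_def)
    \<comment> \<open>Removing \<open>n\<close> from \<open>n \<otimes> k\<close> leaves
      \<open>k \<in> C\<close>, which the choice of \<open>O'\<close> forbids.\<close>
    have "inv n \<in> O'" using nk N subgroup.m_inv_closed[OF sN] by blast
    then have "inv n \<otimes> (r c \<otimes> inv (r d)) \<notin> C" using cd by (auto simp: O'_def I_def)
    moreover have "inv n \<otimes> (n \<otimes> k) = k"
      using nk subgroup.mem_carrier[OF sN] subgroup.mem_carrier[OF C(1)] by (simp add: m_assoc[symmetric])
    ultimately show False using nk by simp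
  qed
  moreover have "(\<lambda>c. (N <#> C) #> r c) ` F \<subseteq> rcosets (N <#> C)"
    using r by (auto simp: RCOSETS_def)
  ultimately have "M \<le> card (rcosets (N <#> C))"
    using F open_subgroup_finite_index[OF V(1,2)] card_inj_on_le by blast
  then show ?thesis using that N O'_def by blast
qed

section \<open>Topological generation and the rank gradient\<close>

lemma top_generates_subset: "top_generates G T S B \<Longrightarrow> S \<subseteq> B \<and> B \<subseteq> carrier G"
  unfolding top_generates_def using closure_of_subset_topspace[of T] by auto

text \<open>Schreier's bound is applied to the dense subgroup \<open>?D\<close> of \<open>B\<close>
  and then passed to closures: since \<open>V\<close> is clopen, \<open>?D \<inter> V\<close> has
  closure \<open>B \<inter> V\<close>.\<close>

lemma top_generates_open_subgroup:
  assumes S: "finite S" "top_generates G T S B" and V: "subgroup V G" "openin T V"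
  obtains S' where "finite S'" "card S' \<le> card ((#>) V ` B) * card S" "top_generates G T S' (B \<inter> V)"
proof -
  have SB: "S \<subseteq> B" "B \<subseteq> carrier G" using top_generates_subset[OF S(2)] by auto
  let ?D = "generate G S"
  have cl: "T closure_of ?D = B" using S by (simp add: top_generates_def)
  have DG: "?D \<subseteq> carrier G" using SB by (meson generate_incl order_trans)
  then have DB: "?D \<subseteq> B" using cl closure_of_subset[of ?D T] by simp
  have fin: "finite ((#>) V ` B)"
    using open_subgroup_finite_index[OF V] SB finite_subset[OF image_mono] by (metis rcosets_eq_image)
  have "finite ((#>) V ` ?D)" and le: "card ((#>) V ` ?D) \<le> card ((#>) V ` B)"
    using fin DB by (meson finite_subset image_mono, meson card_mono fin image_mono DB)
  then obtain S' where S': "finite S'" "card S' \<le> card ((#>) V ` ?D) * card S" "generate G S' = ?D \<inter> V"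
    using schreier_generators[OF _ S(1) V(1)] SB by blast
  have "card S' \<le> card ((#>) V ` B) * card S" using S'(2) le by (meson le_trans mult_le_mono1)
  moreover have "T closure_of (?D \<inter> V) = B \<inter> V"
  proof
    show "T closure_of (?D \<inter> V) \<subseteq> B \<inter> V"
      using closure_of_mono[of "?D \<inter> V" ?D T] closure_of_minimal[OF _ open_subgroup_closed[OF V], of "?D \<inter> V"] cl by auto
    show "B \<inter> V \<subseteq> T closure_of (?D \<inter> V)"
      using openin_Int_closure_of_subset[OF V(2), of ?D] cl by (simp add: Int_commute)
  qed
  moreover have "S' \<subseteq> B \<inter> V" using S'(3) DB generate.incl[of _ S' G] by blast
  ultimately show ?thesis using that[OF S'(1)] S'(3) by (simp add: top_generates_def)
qed

text \<open>A closed subgroup of finite index is open, so it contributes to the infimum, and any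
  finite generating set bounds its rank.\<close>

lemma rank_gradient_le:
  assumes S: "finite S" "top_generates G T S H" and H: "subgroup H G" "closedin T H" "finite (rcosets H)"
  shows "rank_gradient G T * card (rcosets H) \<le> real (card S) - 1"
proof -
  let ?E = "{(real (top_rank G T U) - 1) / real (group_index G U) | U. open_subgroup G T U}"
  have "bdd_below ?E"
  \<comment> \<open>Ranks are at least 0, so a quotient is at least -1 when the index is positive;
    with index 0, division gives 0.\<close>
  proof (rule bdd_belowI[of _ "-1"])
    fix x assume "x \<in> ?E"
    then obtain U where x: "x = (real (top_rank G T U) - 1) / real (group_index G U)" by blast
    show "-1 \<le> x"
    proof (cases "group_index G U = 0")
      case False
      then have "1 \<le> real (group_index G U)" by simp
      then have "- real (group_index G U) \<le> real (top_rank G T U) - 1" by linarith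
      then show ?thesis unfolding x using False by (simp add: field_simps)
    qed (simp add: x)
  qed
  moreover have "open_subgroup G T H"
    using H closed_finite_index_subgroup_open by (simp add: open_subgroup_def)
  ultimately have "rank_gradient G T \<le> (real (top_rank G T H) - 1) / real (group_index G H)"
    unfolding rank_gradient_def by (intro cInf_lower) auto
  moreover have "top_rank G T H \<le> card S"
    unfolding top_rank_def by (rule Least_le) (use S in blast)
  moreover have "0 < group_index G H"
    using H subgroup.subgroup_in_rcosets[OF H(1) is_group] by (auto simp: group_index_def card_gt_0_iff)
  ultimately show ?thesis by (simp add: group_index_def field_simps)
qed

lemma top_generates_join:
  assumes "top_generates G T S A" "top_generates G T R B"
  shows "top_generates G T (S \<union> R) (T closure_of (generate G (A \<union> B)))"
proof -
  note A = top_generates_subset[OF assms(1)] and B = top_generates_subset[OF assms(2)]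
  have sub: "A \<union> B \<subseteq> carrier G" "S \<union> R \<subseteq> carrier G" using A B by auto
  let ?C = "T closure_of (generate G (S \<union> R))"
  have "A \<subseteq> ?C" "B \<subseteq> ?C"
    using assms closure_of_mono[OF mono_generate[of S "S \<union> R"], of T]
      closure_of_mono[OF mono_generate[of R "S \<union> R"], of T]
    by (auto simp: top_generates_def)
  then have "generate G (A \<union> B) \<subseteq> ?C"
    using closure_of_subgroup[OF generate_is_subgroup[OF sub(2)]] by (intro generate_subgroup_incl) auto
  then have 1: "T closure_of (generate G (A \<union> B)) \<subseteq> ?C" by (intro closure_of_minimal) auto
  have 2: "?C \<subseteq> T closure_of (generate G (A \<union> B))"
    using A B by (intro closure_of_mono mono_generate) auto
  have "A \<union> B \<subseteq> T closure_of (generate G (A \<union> B))"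
    using closure_of_subset[of "generate G (A \<union> B)" T] generate_incl[OF sub(1)] generate.incl[of _ "A \<union> B" G] by auto
  then show ?thesis using A B 1 2 by (auto simp: top_generates_def)
qed

text \<open>The join lies in \<open>V\<close>, so a finite index would be at least that of
  \<open>V\<close>, and \<open>rank_gradient_le\<close> would contradict \<open>less\<close>. The
  coset count in \<open>less\<close> is the index of \<open>B \<inter> V\<close> in
  \<open>B\<close>; its \<open>+ 1\<close> matches the \<open>- 1\<close> in the rank
  gradient.\<close>

lemma join_infinite_index:
  assumes S: "finite S" "top_generates G T S A" and R: "finite R" "top_generates G T R B"
    and V: "subgroup V G" "openin T V" "A \<subseteq> V" and pos: "rank_gradient G T > 0"
    and less: "real (card S + card ((#>) V ` B) * card R) < rank_gradient G T * card (rcosets V) + 1"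
  shows "infinite (rcosets (T closure_of (generate G (A \<union> (B \<inter> V)))))"
proof
  let ?H = "T closure_of (generate G (A \<union> (B \<inter> V)))"
  assume fin: "finite (rcosets ?H)"
  obtain R' where R': "finite R'" "card R' \<le> card ((#>) V ` B) * card R" "top_generates G T R' (B \<inter> V)"
    using top_generates_open_subgroup[OF R V(1,2)] .
  have VG: "V \<subseteq> carrier G" using V subgroup.subset by blast
  have H: "subgroup ?H G" using V VG by (intro closure_of_subgroup generate_is_subgroup) auto
  have HV: "?H \<subseteq> V"
    using V open_subgroup_closed[OF V(1,2)] by (intro closure_of_minimal generate_subgroup_incl) auto
  have "rank_gradient G T * card (rcosets ?H) \<le> real (card (S \<union> R')) - 1"
    using S R' fin H by (intro rank_gradient_le top_generates_join) auto
  moreover have "rank_gradient G T * card (rcosets V) \<le> rank_gradient G T * card (rcosets ?H)"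
    using rcosets_finite_mono(2)[OF H V(1) HV fin] pos by simp
  moreover have "card (S \<union> R') \<le> card S + card ((#>) V ` B) * card R"
    using card_Un_le[of S R'] R' by linarith
  ultimately show False using less by (smt (verit) of_nat_le_iff)
qed

lemma finite_transversal:
  assumes A: "A \<subseteq> carrier G" and V: "subgroup V G" "openin T V"
  obtains F where "finite F" "F \<subseteq> A" "\<And>a. a \<in> A \<Longrightarrow> \<exists>f\<in>F. a \<otimes> inv f \<in> V"
proof -
  have "finite ((#>) V ` A)"
    using open_subgroup_finite_index[OF V] A finite_subset[OF image_mono] by (metis rcosets_eq_image)
  from finite_subset_image[OF this, of "(#>) V" A] obtain F where F: "F \<subseteq> A" "finite F" "(#>) V ` A = (#>) V ` F" by blast
  have "\<exists>f\<in>F. a \<otimes> inv f \<in> V" if a: "a \<in> A" for a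
  proof -
    obtain f where "f \<in> F" "V #> a = V #> f" using a F(3) by blast
    then show ?thesis using rcos_eq_iff[OF V(1), of a f] a A F(1) by blast
  qed
  then show ?thesis using that F by blast
qed

section \<open>Products of subgroups of infinite index\<close>

text \<open>Passing to a large-index \<open>W\<close> containing \<open>B\<close> multiplies the rank gradient by the index of \<open>W\<close>,
  which makes it exceed the number of generators of \<open>B\<close>; the price is that \<open>A\<close> shrinks to \<open>A \<inter> W\<close>.\<close>

lemma open_subgroups_join_infinite_index:
  assumes pos: "rank_gradient G T > 0"
    and A: "closed_subgroup G T A" "top_fin_gen G T A" "infinite (rcosets A)"
    and B: "closed_subgroup G T B" "top_fin_gen G T B" "infinite (rcosets B)"
  obtains V W where "subgroup V G" "openin T V" "subgroup W G" "openin T W"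
    "infinite (rcosets (T closure_of (generate G ((A \<inter> W) \<union> (B \<inter> V)))))"
proof -
  let ?d = "rank_gradient G T"
  have sA: "subgroup A G" "closedin T A" and sB: "subgroup B G" "closedin T B"
    using A B by (auto simp: closed_subgroup_def)
  obtain S R where S: "finite S" "top_generates G T S A" and R: "finite R" "top_generates G T R B"
    using A B by (auto simp: top_fin_gen_def)
  \<comment> \<open>The index \<open>n\<close> of \<open>W\<close> is taken so large that
    \<open>?d * n\<close> is at least \<open>card R + 1\<close>.\<close>
  obtain N where N: "N \<lhd> G" "openin T N" "nat \<lceil>(card R + 1) / ?d\<rceil> \<le> card (rcosets (N <#> B))"
    using open_normal_subgroup_large_index[OF sB B(3), of "carrier G"]
    by (metis one_closed openin_topspace topspace_eq)
  define W where "W = N <#> B"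
  note W = normal_mult_open[OF N(1,2) sB(1), folded W_def]
  define n where "n = card (rcosets W)"
  have "(card R + 1) / ?d \<le> n" using N(3) unfolding n_def W_def by linarith
  then have n: "card R + 1 \<le> ?d * n" using pos by (simp add: field_simps)
  obtain S' where S': "finite S'" "top_generates G T S' (A \<inter> W)"
    using top_generates_open_subgroup[OF S W(1,2)] by blast
  have sAW: "subgroup (A \<inter> W) G" using sA W by (simp add: subgroups_Inter_pair)
  have cAW: "closedin T (A \<inter> W)" using sA open_subgroup_closed[OF W(1,2)] by blast
  have iAW: "infinite (rcosets (A \<inter> W))"
    using rcosets_finite_mono(1)[OF sAW sA(1)] A(3) by blast
  \<comment> \<open>Since \<open>N' \<subseteq> W\<close>, also \<open>V \<subseteq> W\<close>, and
    the factor \<open>n\<close> in the bound cancels to give index \<open>m > card S'\<close> of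
    \<open>V\<close> in \<open>W\<close>.\<close>
  obtain N' where N': "N' \<lhd> G" "openin T N'" "N' \<subseteq> W" "(card S' + 1) * n \<le> card (rcosets (N' <#> (A \<inter> W)))"
    using open_normal_subgroup_large_index[OF sAW cAW iAW W(2)] subgroup.one_closed[OF W(1)] by metis
  define V where "V = N' <#> (A \<inter> W)"
  note V = normal_mult_open[OF N'(1,2) sAW, folded V_def]
  have VW: "V \<subseteq> W" unfolding V_def set_mult_def using N'(3) subgroup.m_closed[OF W(1)] by blast
  define m where "m = card ((#>) V ` W)"
  have nm: "card (rcosets V) = n * m"
    unfolding n_def m_def by (rule card_rcosets_mult[OF V(1) W(1) VW])
  have "n > 0" using n by (auto intro!: gr0I)
  moreover have "(card S' + 1) * n \<le> m * n" using N'(4) nm unfolding V_def by (simp only: mult.commute)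
  ultimately have m: "card S' + 1 \<le> m" by (simp only: mult_le_cancel2)
  \<comment> \<open>Here \<open>B \<subseteq> W\<close> pays off: \<open>B\<close> meets at most
    \<open>m\<close> cosets of \<open>V\<close>, out of \<open>n * m\<close> in the whole
    group.\<close>
  have "card ((#>) V ` B) \<le> m"
    unfolding m_def
  proof (rule card_mono)
    show "finite ((#>) V ` W)"
      using open_subgroup_finite_index[OF V(1,2)] subgroup.subset[OF W(1)] finite_subset[OF image_mono] by (metis rcosets_eq_image)
    show "(#>) V ` B \<subseteq> (#>) V ` W" using W(4) by blast
  qed
  then have "card S' + card ((#>) V ` B) * card R < m + m * card R"
    using m by (intro add_less_le_mono mult_le_mono1) auto
  then have "real (card S' + card ((#>) V ` B) * card R) < real (m + m * card R)" by (rule of_nat_less_iff[THEN iffD2])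
  also have "\<dots> = (card R + 1) * real m" by (simp add: algebra_simps)
  also have "\<dots> \<le> ?d * n * m" using n by (intro mult_right_mono) auto
  also have "\<dots> \<le> ?d * card (rcosets V) + 1" using nm by simp
  finally have "infinite (rcosets (T closure_of (generate G ((A \<inter> W) \<union> (B \<inter> V)))))"
    using S' R V pos by (intro join_infinite_index) auto
  then show ?thesis using that V W by blast
qed

text \<open>\<open>H\<close> is the join just found. It contains \<open>A \<inter> W\<close> and
  \<open>B \<inter> V\<close>, which have finite index in \<open>A\<close> and \<open>B\<close>, so
  finite transversals yield \<open>P\<close> and \<open>Q\<close>.\<close>

lemma product_cover:
  assumes pos: "rank_gradient G T > 0"
    and A: "closed_subgroup G T A" "top_fin_gen G T A" "infinite (rcosets A)"
    and B: "closed_subgroup G T B" "top_fin_gen G T B" "infinite (rcosets B)"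
  obtains H P Q where "subgroup H G" "closedin T H" "infinite (rcosets H)"
    "finite P" "P \<subseteq> carrier G" "finite Q" "Q \<subseteq> carrier G"
    "\<forall>a\<in>A. \<forall>b\<in>B. \<exists>p\<in>P. \<exists>q\<in>Q. \<exists>h\<in>H. a \<otimes> b = p \<otimes> h \<otimes> q"
proof -
  obtain V W where V: "subgroup V G" "openin T V" and W: "subgroup W G" "openin T W"
    and inf: "infinite (rcosets (T closure_of (generate G ((A \<inter> W) \<union> (B \<inter> V)))))"
    using open_subgroups_join_infinite_index[OF assms] .
  define H where "H = T closure_of (generate G ((A \<inter> W) \<union> (B \<inter> V)))"
  have sA: "subgroup A G" and sB: "subgroup B G" using A B by (auto simp: closed_subgroup_def)
  note AG = subgroup.subset[OF sA] and BG = subgroup.subset[OF sB]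
  have sub: "(A \<inter> W) \<union> (B \<inter> V) \<subseteq> carrier G" using AG BG by auto
  have H: "subgroup H G" unfolding H_def using sub by (intro closure_of_subgroup generate_is_subgroup)
  have "(A \<inter> W) \<union> (B \<inter> V) \<subseteq> H"
    unfolding H_def using closure_of_subset[of _ T] generate_incl[OF sub] generate.incl[of _ _ G]
    by (metis subset_iff topspace_eq)
  then have AH: "A \<inter> W \<subseteq> H" and BH: "B \<inter> V \<subseteq> H" by auto
  obtain P where P: "finite P" "P \<subseteq> A" "\<And>a. a \<in> A \<Longrightarrow> \<exists>f\<in>P. a \<otimes> inv f \<in> W"
    using finite_transversal[OF AG W] by blast
  obtain Q where Q: "finite Q" "Q \<subseteq> B" "\<And>a. a \<in> B \<Longrightarrow> \<exists>f\<in>Q. a \<otimes> inv f \<in> V"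
    using finite_transversal[OF BG V] by blast
  have "\<exists>p\<in>m_inv G ` P. \<exists>q\<in>Q. \<exists>h\<in>H. a \<otimes> b = p \<otimes> h \<otimes> q" if ab: "a \<in> A" "b \<in> B" for a b
  proof -
    \<comment> \<open>Applying the transversal to \<open>inv a\<close> turns right cosets into left
      ones: \<open>f \<otimes> a\<close> lies in \<open>H\<close>, so \<open>a\<close> is
      \<open>inv f\<close> times an element of \<open>H\<close>.\<close>
    obtain f where f: "f \<in> P" "inv a \<otimes> inv f \<in> W" using P(3)[of "inv a"] ab subgroup.m_inv_closed[OF sA] by blast
    obtain q where q: "q \<in> Q" "b \<otimes> inv q \<in> V" using Q(3) ab by blast
    have "inv a \<otimes> inv f \<in> H"
      using f AH ab P(2) subgroup.m_closed[OF sA] subgroup.m_inv_closed[OF sA] by blast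
    moreover have "b \<otimes> inv q \<in> H"
      using q BH ab Q(2) subgroup.m_closed[OF sB] subgroup.m_inv_closed[OF sB] by blast
    ultimately have h: "inv (inv a \<otimes> inv f) \<otimes> (b \<otimes> inv q) \<in> H"
      using subgroup.m_closed[OF H] subgroup.m_inv_closed[OF H] by blast
    have c: "a \<in> carrier G" "b \<in> carrier G" "f \<in> carrier G" "q \<in> carrier G" using ab f q P Q AG BG by auto
    have "a \<otimes> b = inv f \<otimes> (inv (inv a \<otimes> inv f) \<otimes> (b \<otimes> inv q)) \<otimes> q"
    proof -
      have "inv f \<otimes> (inv (inv a \<otimes> inv f) \<otimes> (b \<otimes> inv q)) \<otimes> q = inv f \<otimes> (f \<otimes> (a \<otimes> b))"
        using c by (simp add: inv_mult_group m_assoc)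
      then show ?thesis using c by (simp add: m_assoc[symmetric])
    qed
    then show ?thesis using h f q by blast
  qed
  then have "\<forall>a\<in>A. \<forall>b\<in>B. \<exists>p\<in>m_inv G ` P. \<exists>q\<in>Q. \<exists>h\<in>H. a \<otimes> b = p \<otimes> h \<otimes> q"
    by blast
  moreover have "closedin T H" "infinite (rcosets H)" using inf by (simp_all add: H_def)
  moreover have "m_inv G ` P \<subseteq> carrier G" "Q \<subseteq> carrier G" using P Q AG BG by auto
  ultimately show ?thesis
    using that[OF H _ _ finite_imageI[OF P(1)] _ Q(1)] by simp
qed

text \<open>Both sides are compared by counting cosets of \<open>N\<close>: the cosets of \<open>N\<close> in \<open>NAB\<close> lie in
  \<open>card P * card Q\<close> two-sided translates of \<open>NH\<close>.\<close>

lemma coset_count_product_cover: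
  assumes N: "N \<lhd> G" "openin T N" and A: "subgroup A G" and H: "subgroup H G" and B: "B \<subseteq> carrier G"
    and PQ: "finite P" "P \<subseteq> carrier G" "finite Q" "Q \<subseteq> carrier G"
    and cover: "\<forall>a\<in>A. \<forall>b\<in>B. \<exists>p\<in>P. \<exists>q\<in>Q. \<exists>h\<in>H. a \<otimes> b = p \<otimes> h \<otimes> q"
  shows "card ((#>) (N <#> A) ` B) * card (rcosets (N <#> H)) \<le> card P * card Q * card (rcosets (N <#> A))"
proof -
  have sN: "subgroup N G" using N normal_imp_subgroup by blast
  note NG = subgroup.subset[OF sN] and HG = subgroup.subset[OF H] and AG = subgroup.subset[OF A]
  let ?V = "N <#> A" and ?M = "N <#> H"
  note V = normal_mult_open[OF N A] and M = normal_mult_open[OF N H]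
  note VG = subgroup.subset[OF V(1)] and MG = subgroup.subset[OF M(1)]
  let ?f = "\<lambda>Y. card ((#>) N ` Y)"
  have fin: "finite ((#>) N ` Y)" if "Y \<subseteq> carrier G" for Y
    using open_subgroup_finite_index[OF sN N(2)] that finite_subset[OF image_mono] by (metis rcosets_eq_image)
  let ?t = "\<lambda>(p, q). (#>) N ` (\<lambda>x. p \<otimes> x \<otimes> q) ` ?M"
  have "(#>) N ` (?V <#> B) \<subseteq> (\<Union>i\<in>P \<times> Q. ?t i)"
  proof
    fix z assume "z \<in> (#>) N ` (?V <#> B)"
    then obtain n a b where nab: "n \<in> N" "a \<in> A" "b \<in> B" "z = N #> (n \<otimes> a \<otimes> b)"
      by (auto simp: set_mult_def)
    obtain p q h where pqh: "p \<in> P" "q \<in> Q" "h \<in> H" "a \<otimes> b = p \<otimes> h \<otimes> q" using cover nab by blast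
    have c: "n \<in> carrier G" "a \<in> carrier G" "b \<in> carrier G" using nab NG AG B by auto
    have "z = N #> n #> (a \<otimes> b)" using nab c NG by (simp add: coset_mult_assoc m_assoc)
    also have "N #> n = N" using coset_join2[OF c(1) sN nab(1)] .
    finally have "z = N #> (p \<otimes> h \<otimes> q)" using pqh by simp
    moreover have "h \<in> ?M" using pqh M(4) by blast
    ultimately show "z \<in> (\<Union>i\<in>P \<times> Q. ?t i)" using pqh by auto
  qed
  moreover have tr: "finite (?t i) \<and> card (?t i) \<le> ?f ?M" if "i \<in> P \<times> Q" for i
    using card_rcos_image_translate_le[OF N(1) MG fin[OF MG]] that PQ by (auto simp: subset_iff)
  ultimately have "?f (?V <#> B) \<le> card (\<Union>i\<in>P \<times> Q. ?t i)"
    using PQ by (intro card_mono) auto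
  also have "\<dots> \<le> (\<Sum>i\<in>P \<times> Q. card (?t i))" using PQ by (intro card_UN_le) auto
  also have "\<dots> \<le> (\<Sum>i\<in>P \<times> Q. ?f ?M)" using tr by (intro sum_mono) auto
  also have "\<dots> = card P * card Q * ?f ?M" by (simp add: card_cartesian_product)
  finally have 1: "card ((#>) ?V ` B) * ?f ?V \<le> card P * card Q * ?f ?M"
    using card_rcos_image_mult[OF sN V(1) V(3) B] by simp
  \<comment> \<open>Both products are the index of \<open>N\<close>; this trades numbers of
    \<open>N\<close>-cosets for indices, after which the common factor \<open>?f ?V\<close>
    cancels.\<close>
  have 2: "card (rcosets ?V) * ?f ?V = card (rcosets ?M) * ?f ?M"
    using card_rcosets_mult[OF sN V(1,3)] card_rcosets_mult[OF sN M(1,3)] by simp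
  have "?f ?V > 0" using fin[OF VG] subgroup.one_closed[OF V(1)] by (auto simp: card_gt_0_iff)
  moreover have "card ((#>) ?V ` B) * card (rcosets ?M) * ?f ?V \<le> card P * card Q * card (rcosets ?V) * ?f ?V"
    using mult_le_mono2[OF 1, of "card (rcosets ?M)"] 2 by (simp add: ac_simps)
  ultimately show ?thesis by simp
qed

end

theorem theorem5p1:
  fixes \<Gamma> :: "('a, 'b) monoid_scheme" and T :: "'a topology" and A B :: "'a set"
  assumes "profinite_group \<Gamma> T"
    and "top_fin_gen \<Gamma> T (carrier \<Gamma>)"
    and "rank_gradient \<Gamma> T > 0"
    and "closed_subgroup \<Gamma> T A" and "top_fin_gen \<Gamma> T A" and "infinite (rcosets\<^bsub>\<Gamma>\<^esub> A)"
    and "closed_subgroup \<Gamma> T B" and "top_fin_gen \<Gamma> T B" and "infinite (rcosets\<^bsub>\<Gamma>\<^esub> B)"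
  shows "\<exists>B0. subgroup B0 \<Gamma> \<and> B0 \<subseteq> B \<and> openin (subtopology T B) B0 \<and>
              infinite (rcosets\<^bsub>\<Gamma>\<^esub> (T closure_of (generate \<Gamma> (A \<union> B0))))"
proof -
  interpret profinite \<Gamma> T
    using assms(1) by (simp add: profinite_def profinite_axioms_def profinite_group_def)
  let ?d = "rank_gradient \<Gamma> T"
  have sA: "subgroup A \<Gamma>" "closedin T A" and sB: "subgroup B \<Gamma>"
    using assms by (auto simp: closed_subgroup_def)
  obtain S R where S: "finite S" "top_generates \<Gamma> T S A" and R: "finite R" "top_generates \<Gamma> T R B"
    using assms by (auto simp: top_fin_gen_def)
  obtain H P Q where H: "subgroup H \<Gamma>" "closedin T H" "infinite (rcosets\<^bsub>\<Gamma>\<^esub> H)"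
    and PQ: "finite P" "P \<subseteq> carrier \<Gamma>" "finite Q" "Q \<subseteq> carrier \<Gamma>"
    and cover: "\<forall>a\<in>A. \<forall>b\<in>B. \<exists>p\<in>P. \<exists>q\<in>Q. \<exists>h\<in>H. a \<otimes>\<^bsub>\<Gamma>\<^esub> b = p \<otimes>\<^bsub>\<Gamma>\<^esub> h \<otimes>\<^bsub>\<Gamma>\<^esub> q"
    using product_cover[OF assms(3-9)] by metis
  define l where "l = card P * card Q"
  \<comment> \<open>First make the index of \<open>N\<^sub>1 <#> H\<close> large compared with
    \<open>l * card R\<close>; the \<open>+ 1\<close> keeps it positive so that \<open>q\<close> can
    be cancelled at the end.\<close>
  obtain N\<^sub>1 where N\<^sub>1: "N\<^sub>1 \<lhd> \<Gamma>" "openin T N\<^sub>1"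
      "nat \<lceil>2 * (l * card R) / ?d\<rceil> + 1 \<le> card (rcosets\<^bsub>\<Gamma>\<^esub> (N\<^sub>1 <#>\<^bsub>\<Gamma>\<^esub> H))"
    using open_normal_subgroup_large_index[OF H, of "carrier \<Gamma>"]
    by (metis one_closed openin_topspace topspace_eq)
  have "\<one>\<^bsub>\<Gamma>\<^esub> \<in> N\<^sub>1" using N\<^sub>1(1) normal_imp_subgroup subgroup.one_closed by blast
  \<comment> \<open>Shrinking to \<open>N \<subseteq> N\<^sub>1\<close> makes the index of
    \<open>N <#> A\<close> large and can only increase that of \<open>N <#> H\<close>, so both
    bounds hold for one \<open>N\<close>.\<close>
  then obtain N where N: "N \<lhd> \<Gamma>" "openin T N" "N \<subseteq> N\<^sub>1"
      "nat \<lceil>2 * card S / ?d\<rceil> \<le> card (rcosets\<^bsub>\<Gamma>\<^esub> (N <#>\<^bsub>\<Gamma>\<^esub> A))"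
    using open_normal_subgroup_large_index[OF sA assms(6) N\<^sub>1(2)] by metis
  define V where "V = N <#>\<^bsub>\<Gamma>\<^esub> A"
  define k where "k = card ((#>\<^bsub>\<Gamma>\<^esub>) V ` B)"
  define m where "m = card (rcosets\<^bsub>\<Gamma>\<^esub> V)"
  define q where "q = card (rcosets\<^bsub>\<Gamma>\<^esub> (N <#>\<^bsub>\<Gamma>\<^esub> H))"
  note V = normal_mult_open[OF N(1,2) sA(1), folded V_def]
  have "card (rcosets\<^bsub>\<Gamma>\<^esub> (N\<^sub>1 <#>\<^bsub>\<Gamma>\<^esub> H)) \<le> q"
    unfolding q_def
  proof (rule rcosets_finite_mono(2))
    show "N <#>\<^bsub>\<Gamma>\<^esub> H \<subseteq> N\<^sub>1 <#>\<^bsub>\<Gamma>\<^esub> H" using N(3) by (auto simp: set_mult_def)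
  qed (use normal_mult_open[OF N(1,2) H(1)] normal_mult_open[OF N\<^sub>1(1,2) H(1)] open_subgroup_finite_index in auto)
  then have "2 * (l * card R) / ?d \<le> q" and q0: "q > 0" using N\<^sub>1(3) by linarith+
  then have q: "2 * (l * card R) \<le> ?d * q" using assms(3) by (simp add: field_simps)
  have "2 * card S / ?d \<le> m" using N(4) unfolding m_def V_def by linarith
  then have m: "2 * card S \<le> ?d * m" using assms(3) by (simp add: field_simps)
  \<comment> \<open>The fraction \<open>k / m\<close> of the cosets of \<open>V\<close> that meet
    \<open>B\<close> is at most \<open>l / q\<close>, whatever the size of \<open>m\<close>.\<close>
  have "k * q \<le> l * m"
    unfolding k_def q_def l_def m_def V_def
    by (rule coset_count_product_cover[OF N(1,2) sA(1) H(1) subgroup.subset[OF sB] PQ cover])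
  then have "2 * (real k * card R) * q \<le> 2 * (l * card R) * real m"
    using mult_right_mono[of "real (k * q)" "real (l * m)" "2 * real (card R)"]
    by (simp only: of_nat_le_iff) (simp add: ac_simps)
  also have "\<dots> \<le> ?d * q * m" using q by (intro mult_right_mono) auto
  finally have "2 * (real k * card R) * q \<le> (?d * m) * q" by (simp add: ac_simps)
  then have "2 * (real k * card R) \<le> ?d * m" using q0 by simp
  \<comment> \<open>The generators of \<open>A\<close> and those of \<open>B \<inter> V\<close> each
    account for at most half of \<open>?d * m\<close>.\<close>
  then have "real (card S + k * card R) < ?d * m + 1" using m by simp
  then have "infinite (rcosets\<^bsub>\<Gamma>\<^esub> (T closure_of (generate \<Gamma> (A \<union> (B \<inter> V)))))"
    using S R V assms(3) unfolding k_def m_def by (intro join_infinite_index) auto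
  moreover have "subgroup (B \<inter> V) \<Gamma>" using sB V(1) by (rule subgroups_Inter_pair)
  moreover have "openin (subtopology T B) (B \<inter> V)"
    using V(2) by (auto simp: openin_subtopology)
  ultimately show ?thesis by blast
qed

end
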